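(* Let $\phi\in\Phi$ with domain $(-\lambda_0,\lambda_0)$, and let $(S(n),F(n))$ be a martingale with martingale differences $\{\xi(i)\}$, $S(n)=\sum_{i=1}^n\xi(i)$, such that for every $k=1,2,\dots$ one has $\xi(k)\in B(F(k-1),\phi)$ and $$\sup_k\|\xi(k)\|B(F(k-1),\phi)\le 1,$$ or equivalently, for all $k$ and all $\lambda\in(-\lambda_0,\lambda_0)$, $$\mathbf E[\exp(\lambda\xi(k))\mid F(k-1)]\le\exp[\phi(\lambda)]\quad\text{a.s.}$$ Then for every $n\ge 1$ and $x>0$, $$Q_n(x)\le 2\exp\left(-\{\overline{\phi}\}^*(x\sqrt n)\right).$$
   Context: Let $(\Omega,F,\mathbf P)$ be a probability space with a filtration $F(0)=\{\emptyset,\Omega\}$, $F(i)\subset F(i+1)\subset F$. Random variables $\xi(i)$ are martingale differences relative to $\{F(i)\}$ if $\mathbf E|\xi(i)|<\infty$, $\mathbf E\,\xi(i)=0$, $\xi(i)$ is $F(i)$-measurable, and $\mathbf E[\xi(i)\mid F(k)]=0$ a.s. for all $k=0,1,\dots,i-1$. Put $Q_n(x)=\mathbf P(S(n)/n>x)$ for $x>0$. $\Phi$ is the set of all functions $\phi=\phi(\lambda)$, $\lambda\in(-\lambda_0,\lambda_0)$, with $\lambda_0\in(0,\infty]$ a constant, that are even, strongly convex, take positive values for positive arguments, are twice continuously differentiable in the intervals $|\lambda|\ge 2$, and satisfy $\phi(0)=0$, $\phi''(0)\in(0,\infty)$, $\lim_{\lambda\to\lambda_0}\phi(\lambda)/\lambda=\infty$.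 For a sub-sigma-algebra $\tilde F\subset F$, a centered random variable $\xi$ belongs to $B(\tilde F,\phi)$ if there is a non-random constant $\tau\ge 0$ such that $\mathbf E[\exp(\lambda\xi)\mid\tilde F]\le\exp[\phi(\lambda\tau)]$ a.s. for all $\lambda\in(-\lambda_0,\lambda_0)$; the minimal such $\tau$ is the norm $\|\xi\|B(\tilde F,\phi)$. For $\phi\in\Phi$ define $\overline{\phi}(\lambda)=\sup_{n\ge 1}\left[n\,\phi(\lambda/\sqrt n)\right]$ for $\lambda\in(-\lambda_0,\lambda_0)$. For a function $g$ on $(-\lambda_0,\lambda_0)$, $g^*(u)=\sup_{\lambda\in(-\lambda_0,\lambda_0)}(\lambda u-g(\lambda))$ is its Young–Fenchel transform. *)

theory Defs
  imports "HOL-Probability.Probability"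
begin

section \<open>The class of functions \<open>\<Phi>\<close>\<close>

definition dom_of :: "ereal \<Rightarrow> real set" where
  "dom_of l0 = {l. \<bar>ereal l\<bar> < l0}"

definition strongly_convex_on :: "real set \<Rightarrow> (real \<Rightarrow> real) \<Rightarrow> bool" where
  "strongly_convex_on A f \<longleftrightarrow> convex A \<and>
     (\<exists>m>0. \<forall>x\<in>A. \<forall>y\<in>A. \<forall>t\<in>{0..1}.
        f ((1 - t) * x + t * y) \<le> (1 - t) * f x + t * f y - m / 2 * t * (1 - t) * (x - y)\<^sup>2)"

text \<open>Derivatives are taken within \<open>A\<close>, hence one-sided at endpoints of \<open>A\<close>.\<close>

definition C2_on :: "real set \<Rightarrow> (real \<Rightarrow> real) \<Rightarrow> bool" where
  "C2_on A f \<longleftrightarrow> (\<exists>f' f''.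
     (\<forall>x\<in>A. (f has_real_derivative f' x) (at x within A)) \<and>
     (\<forall>x\<in>A. (f' has_real_derivative f'' x) (at x within A)) \<and>
     continuous_on A f'')"

text \<open>A function with domain \<open>(-\<lambda>\<^sub>0, \<lambda>\<^sub>0)\<close> is a total function together with \<open>\<lambda>\<^sub>0\<close>; its values outside
  the domain are irrelevant. The two lines before the limit condition say that \<open>\<phi>''(0)\<close> exists
  and is positive.\<close>

definition Phi :: "ereal \<Rightarrow> (real \<Rightarrow> real) set" where
  "Phi l0 = {\<phi>. 0 < l0 \<and>
     (\<forall>l\<in>dom_of l0. \<phi> (- l) = \<phi> l) \<and>
     strongly_convex_on (dom_of l0) \<phi> \<and>
     (\<forall>l\<in>dom_of l0. 0 < l \<longrightarrow> 0 < \<phi> l) \<and>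
     C2_on (dom_of l0 \<inter> {l. 2 \<le> \<bar>l\<bar>}) \<phi> \<and>
     \<phi> 0 = 0 \<and>
     (\<forall>\<^sub>F l in nhds 0. \<phi> differentiable (at l)) \<and>
     deriv \<phi> differentiable (at 0) \<and> 0 < deriv (deriv \<phi>) 0 \<and>
     filterlim (\<lambda>l. \<phi> (real_of_ereal l) / real_of_ereal l) at_top (at_left l0)}"

section \<open>The spaces \<open>B\<close>\<close>

text \<open>The function \<open>exp (\<lambda> \<xi>)\<close> need not be integrable, so its conditional expectation is the
  \<open>[0, \<infinity>]\<close>-valued one. When \<open>\<lambda> \<tau>\<close> leaves the domain of \<open>\<phi>\<close>, the
  usual convention \<open>\<phi> = \<infinity>\<close> applies, i.e. there is no constraint.\<close>

definition B_bound :: "'a measure \<Rightarrow> 'a measure \<Rightarrow> ereal \<Rightarrow> (real \<Rightarrow> real) \<Rightarrow> ('a \<Rightarrow> real) \<Rightarrow> real \<Rightarrow> bool" where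
  "B_bound M G l0 \<phi> \<xi> \<tau> \<longleftrightarrow> (\<forall>l\<in>dom_of l0. l * \<tau> \<in> dom_of l0 \<longrightarrow>
     (AE \<omega> in M. nn_cond_exp M G (\<lambda>\<omega>. ennreal (exp (l * \<xi> \<omega>))) \<omega> \<le> ennreal (exp (\<phi> (l * \<tau>)))))"

definition B_space :: "'a measure \<Rightarrow> 'a measure \<Rightarrow> ereal \<Rightarrow> (real \<Rightarrow> real) \<Rightarrow> ('a \<Rightarrow> real) set" where
  "B_space M G l0 \<phi> = {\<xi>. integrable M \<xi> \<and> integral\<^sup>L M \<xi> = 0 \<and>
     (\<exists>\<tau>\<ge>0. B_bound M G l0 \<phi> \<xi> \<tau>)}"

text \<open>The infimum is attained, see \<open>B_bound_B_norm\<close> below.\<close>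

definition B_norm :: "'a measure \<Rightarrow> 'a measure \<Rightarrow> ereal \<Rightarrow> (real \<Rightarrow> real) \<Rightarrow> ('a \<Rightarrow> real) \<Rightarrow> real" where
  "B_norm M G l0 \<phi> \<xi> = Inf {\<tau>. 0 \<le> \<tau> \<and> B_bound M G l0 \<phi> \<xi> \<tau>}"

section \<open>The function \<open>\<phi>\<close>-bar and the Young--Fenchel transform\<close>

text \<open>For \<open>\<phi> \<in> Phi l0\<close> both suprema are over sets bounded above, see \<open>bdd_above_phi_bar\<close> and
  \<open>bdd_above_young_fenchel\<close> below.\<close>

definition phi_bar :: "(real \<Rightarrow> real) \<Rightarrow> real \<Rightarrow> real" where
  "phi_bar \<phi> l = (SUP n\<in>{1::nat..}. real n * \<phi> (l / sqrt (real n)))"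

definition young_fenchel :: "ereal \<Rightarrow> (real \<Rightarrow> real) \<Rightarrow> real \<Rightarrow> real" where
  "young_fenchel l0 g u = (SUP l\<in>dom_of l0. l * u - g l)"

section \<open>Martingale differences\<close>

definition is_filtration :: "'a measure \<Rightarrow> (nat \<Rightarrow> 'a measure) \<Rightarrow> bool" where
  "is_filtration M F \<longleftrightarrow> filtration (space M) F \<and> (\<forall>i. subalgebra M (F i)) \<and>
     sets (F 0) = {{}, space M}"

definition martingale_differences :: "'a measure \<Rightarrow> (nat \<Rightarrow> 'a measure) \<Rightarrow> (nat \<Rightarrow> 'a \<Rightarrow> real) \<Rightarrow> bool" where
  "martingale_differences M F \<xi> \<longleftrightarrow> (\<forall>i\<ge>1.
     integrable M (\<xi> i) \<and> integral\<^sup>L M (\<xi> i) = 0 \<and> \<xi> i \<in> borel_measurable (F i) \<and>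
     (\<forall>k<i. AE \<omega> in M. real_cond_exp M (F k) (\<xi> i) \<omega> = 0))"

definition partial_sum :: "(nat \<Rightarrow> 'a \<Rightarrow> real) \<Rightarrow> nat \<Rightarrow> 'a \<Rightarrow> real" where
  "partial_sum \<xi> n \<omega> = (\<Sum>i=1..n. \<xi> i \<omega>)"

definition Q_tail :: "'a measure \<Rightarrow> (nat \<Rightarrow> 'a \<Rightarrow> real) \<Rightarrow> nat \<Rightarrow> real \<Rightarrow> real" where
  "Q_tail M \<xi> n x = measure M {\<omega> \<in> space M. partial_sum \<xi> n \<omega> / real n > x}"

section \<open>The two forms of the hypothesis on the differences\<close>

text \<open>The supremum is taken in \<^typ>\<open>ereal\<close>, where it exists even if the norms are unbounded.\<close>

definition norms_le_1 where
  "norms_le_1 M F l0 \<phi> \<xi> \<longleftrightarrow>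
     (\<forall>k\<ge>1::nat. \<xi> k \<in> B_space M (F (k - 1)) l0 \<phi>) \<and>
     (SUP k\<in>{1::nat..}. ereal (B_norm M (F (k - 1)) l0 \<phi> (\<xi> k))) \<le> 1"

definition cond_mgf_le where
  "cond_mgf_le M F l0 \<phi> \<xi> \<longleftrightarrow> (\<forall>k\<ge>1::nat. \<forall>l\<in>dom_of l0. AE \<omega> in M.
     nn_cond_exp M (F (k - 1)) (\<lambda>\<omega>. ennreal (exp (l * \<xi> k \<omega>))) \<omega> \<le> ennreal (exp (\<phi> l)))"

section \<open>Well-definedness of the suprema and of the norm\<close>

lemma dom_of_abs_le: "l \<in> dom_of l0 \<Longrightarrow> \<bar>x\<bar> \<le> \<bar>l\<bar> \<Longrightarrow> x \<in> dom_of l0"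
  unfolding dom_of_def by (cases l0) auto

lemma open_dom_of: "open (dom_of l0)"
proof (cases l0)
  case (real r)
  have "dom_of l0 = {-r<..<r}" by (auto simp: dom_of_def real)
  then show ?thesis by simp
next
  case PInf
  have "dom_of l0 = UNIV" by (auto simp: dom_of_def PInf)
  then show ?thesis by simp
next
  case MInf
  have "dom_of l0 = {}" by (auto simp: dom_of_def MInf)
  then show ?thesis by simp
qed

lemma Phi_even: "\<phi> \<in> Phi l0 \<Longrightarrow> l \<in> dom_of l0 \<Longrightarrow> \<phi> \<bar>l\<bar> = \<phi> l"
  unfolding Phi_def by (auto simp: abs_if)

lemma Phi_nonneg:
  assumes "\<phi> \<in> Phi l0" "l \<in> dom_of l0"
  shows "0 \<le> \<phi> l"
proof -
  have "\<bar>l\<bar> \<in> dom_of l0" using assms(2) by (rule dom_of_abs_le) simp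
  then have "0 \<le> \<phi> \<bar>l\<bar>" using assms(1) unfolding Phi_def
    by (cases "l = 0") (auto intro: less_imp_le)
  then show ?thesis using Phi_even[OF assms] by simp
qed

lemma Phi_continuous_on:
  assumes "\<phi> \<in> Phi l0"
  shows "continuous_on (dom_of l0) \<phi>"
proof (rule convex_on_continuous[OF open_dom_of])
  from assms obtain m where m: "m > 0" and c: "convex (dom_of l0)" and
    i: "\<And>x y t. x \<in> dom_of l0 \<Longrightarrow> y \<in> dom_of l0 \<Longrightarrow> t \<in> {0..1} \<Longrightarrow>
      \<phi> ((1 - t) * x + t * y) \<le> (1 - t) * \<phi> x + t * \<phi> y - m / 2 * t * (1 - t) * (x - y)\<^sup>2"
    unfolding Phi_def strongly_convex_on_def by blast
  show "convex_on (dom_of l0) \<phi>"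
  proof (rule convex_onI[OF _ c])
    fix t x y :: real
    assume t: "0 < t" "t < 1" and xy: "x \<in> dom_of l0" "y \<in> dom_of l0"
    have "0 \<le> m / 2 * t * (1 - t) * (x - y)\<^sup>2" using t m by simp
    then show "\<phi> ((1 - t) *\<^sub>R x + t *\<^sub>R y) \<le> (1 - t) * \<phi> x + t * \<phi> y"
      using i[OF xy, of t] t by simp
  qed
qed

lemma Phi_quadratic_at_0:
  assumes "\<phi> \<in> Phi l0"
  obtains d C where "d > 0" "C \<ge> 0" "\<And>x. \<bar>x\<bar> < d \<Longrightarrow> \<phi> x \<le> C * x\<^sup>2"
proof -
  define c where "c = deriv (deriv \<phi>) 0"
  have l0: "0 < l0" and p0: "\<phi> 0 = 0" using assms by (auto simp: Phi_def)
  have "0 \<in> dom_of l0" using l0 by (simp add: dom_of_def zero_ereal_def)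
  then have "\<forall>\<^sub>F x in nhds 0. x \<in> dom_of l0"
    using open_dom_of eventually_nhds_in_open by blast
  moreover have "\<forall>\<^sub>F x in nhds 0. \<phi> differentiable (at x)" using assms by (auto simp: Phi_def)
  ultimately have "\<forall>\<^sub>F x in nhds 0. x \<in> dom_of l0 \<and> \<phi> differentiable (at x)"
    by (rule eventually_conj)
  then obtain d1 where d1: "d1 > 0" "\<And>x::real. \<bar>x\<bar> < d1 \<Longrightarrow> x \<in> dom_of l0 \<and> \<phi> differentiable (at x)"
    unfolding eventually_nhds_metric by (auto simp: dist_real_def)
  have D: "(\<phi> has_real_derivative deriv \<phi> x) (at x)" if "\<bar>x\<bar> < d1" for x
    using d1(2)[OF that] by (auto simp: DERIV_deriv_iff_real_differentiable)
  have z: "deriv \<phi> 0 = 0"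
    by (rule DERIV_local_min[OF D d1(1)]) (use d1 p0 Phi_nonneg[OF assms] in auto)
  have "deriv \<phi> differentiable (at 0)" using assms by (auto simp: Phi_def)
  then have "(deriv \<phi> has_real_derivative c) (at 0)"
    by (simp add: DERIV_deriv_iff_real_differentiable c_def)
  then have "(\<lambda>h. (deriv \<phi> (0 + h) - deriv \<phi> 0) / h) \<midarrow>0\<rightarrow> c" by (simp add: DERIV_def)
  then have "(\<lambda>h. deriv \<phi> h / h) \<midarrow>0\<rightarrow> c" by (simp add: z)
  then obtain d2 where d2: "d2 > 0" "\<And>h. h \<noteq> 0 \<Longrightarrow> \<bar>h\<bar> < d2 \<Longrightarrow> \<bar>deriv \<phi> h / h - c\<bar> < 1"
    unfolding LIM_eq by (metis diff_zero real_norm_def zero_less_one)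
  define C where "C = \<bar>c\<bar> + 1"
  have b: "\<bar>deriv \<phi> h\<bar> \<le> C * \<bar>h\<bar>" if "\<bar>h\<bar> < d2" for h
  proof (cases "h = 0")
    case False
    have "\<bar>deriv \<phi> h / h\<bar> \<le> C" using d2(2)[OF False that] by (auto simp: C_def)
    then show ?thesis using False by (simp add: abs_divide field_simps)
  qed (simp add: z)
  have "\<phi> x \<le> C * x\<^sup>2" if x: "\<bar>x\<bar> < min d1 d2" for x
  proof -
    have pos: "\<phi> y \<le> C * y\<^sup>2" if y: "0 < y" "y < min d1 d2" for y
    proof -
      have "\<exists>z. 0 < z \<and> z < y \<and> \<phi> y - \<phi> 0 = (y - 0) * deriv \<phi> z"
        by (rule MVT2[OF y(1)]) (use D y in auto)
      then obtain z where zz: "0 < z" "z < y" "\<phi> y = y * deriv \<phi> z" by (auto simp: p0)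
      have "deriv \<phi> z \<le> C * z" using b[of z] zz y by auto
      also have "\<dots> \<le> C * y" using zz by (intro mult_left_mono) (auto simp: C_def)
      finally show ?thesis using zz y by (simp add: power2_eq_square algebra_simps)
    qed
    have "\<phi> x = \<phi> \<bar>x\<bar>" using Phi_even[OF assms] d1(2) x by auto
    then show ?thesis using pos[of "\<bar>x\<bar>"] x p0 by (cases "x = 0") auto
  qed
  then show ?thesis using that[of "min d1 d2" C] d1(1) d2(1) by (auto simp: C_def)
qed

lemma bdd_above_phi_bar:
  assumes "\<phi> \<in> Phi l0"
  shows "bdd_above ((\<lambda>n. real n * \<phi> (l / sqrt (real n))) ` {1::nat..})"
proof -
  obtain d C where d: "d > 0" "C \<ge> 0" "\<And>x. \<bar>x\<bar> < d \<Longrightarrow> \<phi> x \<le> C * x\<^sup>2"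
    using Phi_quadratic_at_0[OF assms] by metis
  obtain N :: nat where N: "l\<^sup>2 / d\<^sup>2 < real N" using reals_Archimedean2 by blast
  let ?f = "\<lambda>n. real n * \<phi> (l / sqrt (real n))"
  have "?f n \<le> C * l\<^sup>2" if n: "n \<ge> 1" "n \<ge> N" for n :: nat
  proof -
    have "l\<^sup>2 / d\<^sup>2 < real n" using N n by linarith
    then have "l\<^sup>2 < real n * d\<^sup>2" using d(1) by (simp add: field_simps)
    then have "(l / sqrt (real n))\<^sup>2 < d\<^sup>2" using n by (simp add: power_divide field_simps)
    then have "\<bar>l / sqrt (real n)\<bar> < d" using d(1) by (metis abs_of_pos abs_le_square_iff not_le)
    then have "?f n \<le> real n * (C * (l / sqrt (real n))\<^sup>2)"
      by (intro mult_left_mono d(3)) auto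
    also have "\<dots> = C * l\<^sup>2" using n by (simp add: power_divide field_simps)
    finally show ?thesis .
  qed
  then have "bdd_above (?f ` ({1..} \<inter> {N..}))" by (intro bdd_aboveI2[where M="C * l\<^sup>2"]) auto
  moreover have "bdd_above (?f ` {..<N})" by simp
  ultimately have "bdd_above (?f ` ({1..} \<inter> {N..}) \<union> ?f ` {..<N})" by simp
  moreover have "?f ` {1..} \<subseteq> ?f ` ({1..} \<inter> {N..}) \<union> ?f ` {..<N}"
    unfolding image_Un[symmetric] by (intro image_mono) auto
  ultimately show ?thesis by (rule bdd_above_mono)
qed

lemma bdd_above_young_fenchel:
  assumes "\<phi> \<in> Phi l0"
  shows "bdd_above ((\<lambda>l. l * u - phi_bar \<phi> l) ` dom_of l0)"
proof -
  have l0: "0 < l0" using assms by (auto simp: Phi_def)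
  have "filterlim (\<lambda>l. \<phi> (real_of_ereal l) / real_of_ereal l) at_top (at_left l0)"
    using assms by (auto simp: Phi_def)
  then have "\<forall>\<^sub>F l in at_left l0. \<bar>u\<bar> \<le> \<phi> (real_of_ereal l) / real_of_ereal l"
    by (simp add: filterlim_at_top)
  then obtain b where b: "b < l0" "\<And>l. b < l \<Longrightarrow> l < l0 \<Longrightarrow> \<bar>u\<bar> \<le> \<phi> (real_of_ereal l) / real_of_ereal l"
    using l0 by (auto simp: eventually_at_left)
  obtain L where L: "max 0 b < ereal L" "ereal L < l0"
    using ereal_dense2[of "max 0 b" l0] b(1) l0 by auto
  have "l * u - phi_bar \<phi> l \<le> L * \<bar>u\<bar>" if l: "l \<in> dom_of l0" for l
  proof -
    have "\<phi> l \<le> phi_bar \<phi> l"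
      using cSUP_upper[OF _ bdd_above_phi_bar[OF assms], of 1 l] by (simp add: phi_bar_def)
    moreover have "l * u \<le> \<bar>l\<bar> * \<bar>u\<bar>" by (metis abs_ge_self abs_mult)
    moreover have "0 \<le> L" using L(1) by simp
    moreover have "\<bar>l\<bar> * \<bar>u\<bar> \<le> L * \<bar>u\<bar>" if "\<bar>l\<bar> \<le> L" using that by (simp add: mult_right_mono)
    moreover have "\<bar>l\<bar> * \<bar>u\<bar> \<le> \<phi> l" if "L < \<bar>l\<bar>"
    proof -
      have "b < ereal \<bar>l\<bar>" using L(1) that by (metis less_ereal.simps(1) max_less_iff_conj order_less_trans)
      moreover have "ereal \<bar>l\<bar> < l0" using l by (simp add: dom_of_def)
      ultimately have "\<bar>u\<bar> \<le> \<phi> \<bar>l\<bar> / \<bar>l\<bar>" using b(2)[of "ereal \<bar>l\<bar>"] by simp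
      then show ?thesis using that \<open>0 \<le> L\<close> Phi_even[OF assms l] by (simp add: field_simps)
    qed
    moreover have "0 \<le> \<phi> l" using Phi_nonneg[OF assms l] .
    ultimately show ?thesis by (smt (verit) mult_nonneg_nonneg abs_ge_zero)
  qed
  then show ?thesis by (rule bdd_aboveI2)
qed

lemma B_bound_B_norm:
  assumes "\<phi> \<in> Phi l0" "\<xi> \<in> B_space M G l0 \<phi>"
  shows "0 \<le> B_norm M G l0 \<phi> \<xi>" "B_bound M G l0 \<phi> \<xi> (B_norm M G l0 \<phi> \<xi>)"
proof -
  let ?T = "{\<tau>. 0 \<le> \<tau> \<and> B_bound M G l0 \<phi> \<xi> \<tau>}"
  let ?N = "B_norm M G l0 \<phi> \<xi>"
  have ne: "?T \<noteq> {}" using assms(2) by (auto simp: B_space_def)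
  have bdd: "bdd_below ?T" by (rule bdd_belowI[of _ 0]) auto
  show "0 \<le> ?N" unfolding B_norm_def by (rule cInf_greatest[OF ne]) auto
  have "\<exists>\<tau>. \<tau> \<in> ?T \<and> \<tau> < ?N + 1 / real (Suc n)" for n
    using cInf_lessD[OF ne, of "?N + 1 / real (Suc n)"] by (auto simp: B_norm_def)
  then obtain t where t: "\<And>n. t n \<in> ?T" "\<And>n. t n < ?N + 1 / real (Suc n)" by metis
  have ge: "?N \<le> t n" for n unfolding B_norm_def by (rule cInf_lower[OF t(1) bdd])
  have "(\<lambda>n. ?N + 1 / real (Suc n)) \<longlonglongrightarrow> ?N + 0"
    by (intro tendsto_add tendsto_const LIMSEQ_inverse_real_of_nat[unfolded inverse_eq_divide])
  then have up: "(\<lambda>n. ?N + 1 / real (Suc n)) \<longlonglongrightarrow> ?N" by simp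
  have lim: "t \<longlonglongrightarrow> ?N"
    by (rule tendsto_sandwich[OF always_eventually always_eventually tendsto_const up])
      (use ge less_imp_le[OF t(2)] in blast)+
  show "B_bound M G l0 \<phi> \<xi> ?N"
    unfolding B_bound_def
  proof (intro ballI impI)
    fix l assume l: "l \<in> dom_of l0" "l * ?N \<in> dom_of l0"
    have lim2: "(\<lambda>n. l * t n) \<longlonglongrightarrow> l * ?N" by (intro tendsto_intros lim)
    have ev: "\<forall>\<^sub>F n in sequentially. l * t n \<in> dom_of l0"
      using topological_tendstoD[OF lim2 open_dom_of l(2)] .
    have "isCont \<phi> (l * ?N)"
      using Phi_continuous_on[OF assms(1)] open_dom_of l(2) by (simp add: continuous_on_eq_continuous_at)
    then have "(\<lambda>n. \<phi> (l * t n)) \<longlonglongrightarrow> \<phi> (l * ?N)" using lim2 by (rule isCont_tendsto_compose)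
    then have lim3: "(\<lambda>n. ennreal (exp (\<phi> (l * t n)))) \<longlonglongrightarrow> ennreal (exp (\<phi> (l * ?N)))"
      by (intro tendsto_ennrealI tendsto_exp)
    let ?E = "nn_cond_exp M G (\<lambda>\<omega>. ennreal (exp (l * \<xi> \<omega>)))"
    have "AE \<omega> in M. \<forall>n. l * t n \<in> dom_of l0 \<longrightarrow> ?E \<omega> \<le> ennreal (exp (\<phi> (l * t n)))"
      unfolding AE_all_countable
    proof
      fix n show "AE \<omega> in M. l * t n \<in> dom_of l0 \<longrightarrow> ?E \<omega> \<le> ennreal (exp (\<phi> (l * t n)))"
        using t(1)[of n] l(1) by (cases "l * t n \<in> dom_of l0") (auto simp: B_bound_def)
    qed
    then show "AE \<omega> in M. ?E \<omega> \<le> ennreal (exp (\<phi> (l * ?N)))"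
    proof eventually_elim
      case (elim \<omega>)
      show ?case
        by (rule tendsto_lowerbound[OF lim3]) (use ev elim in \<open>auto elim: eventually_mono\<close>)
    qed
  qed
qed

end

theory Submission
  imports Defs
begin

text \<open>Pulling out the \<open>F (n - 1)\<close>-measurable factor \<open>exp (\<lambda> S(n - 1))\<close> and bounding the conditional
  expectation of \<open>exp (\<lambda> \<xi>(n))\<close> gives \<open>E exp (\<lambda> S(n)) \<le> exp (n \<phi>(\<lambda>))\<close> by induction. In Markov's
  inequality one takes \<open>\<lambda> = l / sqrt n\<close>, so that the exponent \<open>n \<phi>(l / sqrt n) - l x sqrt n\<close> is at most
  \<open>\<phi>\<close>-bar \<open>(l) - l x sqrt n\<close>, and minimises over \<open>l\<close>. This gives the bound even without the factor \<open>2\<close>.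
  The two hypotheses agree because an even convex \<open>\<phi>\<close> with \<open>\<phi>(0) = 0\<close> satisfies
  \<open>\<phi>(\<lambda> \<tau>) \<le> \<phi>(\<lambda>)\<close> for \<open>0 \<le> \<tau> \<le> 1\<close>.\<close>

lemma Phi_mult_le:
  assumes "\<phi> \<in> Phi l0" "l \<in> dom_of l0" "0 \<le> t" "t \<le> 1"
  shows "\<phi> (l * t) \<le> \<phi> l"
proof -
  have "0 \<in> dom_of l0" using assms(2) by (rule dom_of_abs_le) simp
  moreover have "\<phi> 0 = 0" using assms(1) by (simp add: Phi_def)
  moreover obtain m where "m > 0" and
    "\<And>x y t. x \<in> dom_of l0 \<Longrightarrow> y \<in> dom_of l0 \<Longrightarrow> t \<in> {0..1} \<Longrightarrow>
      \<phi> ((1 - t) * x + t * y) \<le> (1 - t) * \<phi> x + t * \<phi> y - m / 2 * t * (1 - t) * (x - y)\<^sup>2"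
    using assms(1) unfolding Phi_def strongly_convex_on_def by blast
  \<comment> \<open>Strong convexity is applied between \<open>0\<close> and \<open>l\<close> with
    weight \<open>t\<close>. The value at \<open>0\<close> vanishes, and the nonnegative quadratic
    term is dropped below.\<close>
  ultimately have "\<phi> (t * l) \<le> t * \<phi> l - m / 2 * t * (1 - t) * l\<^sup>2"
    using assms(2-4) by fastforce
  moreover have "0 \<le> m / 2 * t * (1 - t) * l\<^sup>2"
    using \<open>m > 0\<close> assms(3,4) by simp
  moreover have "t * \<phi> l \<le> \<phi> l"
    using Phi_nonneg[OF assms(1,2)] assms(3,4) by (rule mult_left_le_one_le)
  ultimately show ?thesis by (simp add: mult.commute)
qed

lemma norms_le_1_iff_cond_mgf_le:
  assumes \<phi>: "\<phi> \<in> Phi l0" and md: "martingale_differences M F \<xi>"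
  shows "norms_le_1 M F l0 \<phi> \<xi> \<longleftrightarrow> cond_mgf_le M F l0 \<phi> \<xi>"
proof
  assume n: "norms_le_1 M F l0 \<phi> \<xi>"
  show "cond_mgf_le M F l0 \<phi> \<xi>"
    unfolding cond_mgf_le_def
  proof (intro allI impI ballI)
    fix k :: nat and l assume k: "1 \<le> k" and l: "l \<in> dom_of l0"
    let ?N = "B_norm M (F (k - 1)) l0 \<phi> (\<xi> k)"
    have B: "\<xi> k \<in> B_space M (F (k - 1)) l0 \<phi>" using n k by (simp add: norms_le_1_def)
    have N: "0 \<le> ?N" "?N \<le> 1"
      using B_bound_B_norm(1)[OF \<phi> B] n k by (auto simp: norms_le_1_def SUP_le_iff)
    \<comment> \<open>\<open>B_bound\<close> says nothing about \<open>l\<close> once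
      \<open>l * ?N\<close> leaves the domain, so membership has to be secured first; it follows
      from \<open>?N \<le> 1\<close>.\<close>
    have "l * ?N \<in> dom_of l0"
      using l by (rule dom_of_abs_le) (use N in \<open>simp add: abs_mult mult_left_le\<close>)
    then have "AE \<omega> in M. nn_cond_exp M (F (k - 1)) (\<lambda>\<omega>. ennreal (exp (l * \<xi> k \<omega>))) \<omega>
        \<le> ennreal (exp (\<phi> (l * ?N)))"
      using B_bound_B_norm(2)[OF \<phi> B] l by (simp add: B_bound_def)
    moreover have "AE \<omega> in M. ennreal (exp (\<phi> (l * ?N))) \<le> ennreal (exp (\<phi> l))"
      using Phi_mult_le[OF \<phi> l N] by (simp add: ennreal_leI)
    ultimately show "AE \<omega> in M. nn_cond_exp M (F (k - 1)) (\<lambda>\<omega>. ennreal (exp (l * \<xi> k \<omega>))) \<omega>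
        \<le> ennreal (exp (\<phi> l))"
      by eventually_elim (rule order_trans)
  qed
next
  assume c: "cond_mgf_le M F l0 \<phi> \<xi>"
  \<comment> \<open>The witness is 1: for it, \<open>l * \<tau>\<close> is \<open>l\<close> itself,
    and \<open>B_bound\<close> becomes the conditional estimate.\<close>
  have B: "B_bound M (F (k - 1)) l0 \<phi> (\<xi> k) 1" if "1 \<le> k" for k
    using c that by (simp add: B_bound_def cond_mgf_le_def)
  have "B_norm M (F (k - 1)) l0 \<phi> (\<xi> k) \<le> 1" if "1 \<le> k" for k
    unfolding B_norm_def using B[OF that] by (intro cInf_lower bdd_belowI[of _ 0]) auto
  moreover have "\<xi> k \<in> B_space M (F (k - 1)) l0 \<phi>" if "1 \<le> k" for k
    unfolding B_space_def using B[OF that] md that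
    by (auto simp: martingale_differences_def intro!: exI[of _ 1])
  ultimately show "norms_le_1 M F l0 \<phi> \<xi>"
    by (simp add: norms_le_1_def SUP_le_iff)
qed

lemma partial_sum_measurable:
  assumes "is_filtration M F" "martingale_differences M F \<xi>" "n \<le> k"
  shows "partial_sum \<xi> n \<in> borel_measurable (F k)"
proof -
  have "\<xi> i \<in> borel_measurable (F k)" if i: "i \<in> {1..n}" for i
  proof -
    have f: "filtration (space M) F" using assms(1) by (simp add: is_filtration_def)
    have "i \<le> k" using i assms(3) by simp
    then have "subalgebra (F k) (F i)"
      using filtration.space_F[OF f] filtration.sets_F_mono[OF f] by (simp add: subalgebra_def)
    then show ?thesis
      using assms(2) i by (auto simp: martingale_differences_def intro: measurable_from_subalg)
  qed
  then show ?thesis unfolding partial_sum_def by (intro borel_measurable_sum)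
qed

text \<open>Working in \<open>ennreal\<close> lets the factor be pulled out before anything is known
  to be integrable; finiteness of the exponential moment comes out as part of the bound.\<close>

lemma nn_integral_exp_partial_sum_le:
  assumes "prob_space M" and F: "is_filtration M F" and md: "martingale_differences M F \<xi>"
    and c: "cond_mgf_le M F l0 \<phi> \<xi>" and l: "l \<in> dom_of l0"
  shows "(\<integral>\<^sup>+\<omega>. ennreal (exp (l * partial_sum \<xi> n \<omega>)) \<partial>M) \<le> ennreal (exp (real n * \<phi> l))"
proof (induction n)
  case 0
  interpret prob_space M by fact
  show ?case by (simp add: partial_sum_def emeasure_space_1)
next
  case (Suc n)
  interpret prob_space M by fact
  have sub: "subalgebra M (F k)" for k using F by (simp add: is_filtration_def)
  interpret finite_measure_subalgebra M "F n"
    by unfold_locales (rule sub)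
  let ?f = "\<lambda>\<omega>. ennreal (exp (l * partial_sum \<xi> n \<omega>))"
  let ?g = "\<lambda>\<omega>. ennreal (exp (l * \<xi> (Suc n) \<omega>))"
  have [measurable]: "partial_sum \<xi> n \<in> borel_measurable (F n)"
    by (rule partial_sum_measurable[OF F md order_refl])
  then have f: "?f \<in> borel_measurable (F n)" by measurable
  have [measurable]: "?f \<in> borel_measurable M" by (rule measurable_from_subalg[OF sub f])
  have [measurable]: "\<xi> (Suc n) \<in> borel_measurable M"
    using md by (auto simp: martingale_differences_def)
  have "(\<integral>\<^sup>+\<omega>. ennreal (exp (l * partial_sum \<xi> (Suc n) \<omega>)) \<partial>M) = (\<integral>\<^sup>+\<omega>. ?f \<omega> * ?g \<omega> \<partial>M)"
    by (simp add: partial_sum_def distrib_left exp_add ennreal_mult')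
  also have "\<dots> = (\<integral>\<^sup>+\<omega>. ?f \<omega> * nn_cond_exp M (F n) ?g \<omega> \<partial>M)"
    by (rule nn_cond_exp_intg[symmetric, OF f]) measurable
  also have "\<dots> \<le> (\<integral>\<^sup>+\<omega>. ?f \<omega> * ennreal (exp (\<phi> l)) \<partial>M)"
  proof (rule nn_integral_mono_AE)
    \<comment> \<open>This is the hypothesis at \<open>k = Suc n\<close>, where
      \<open>F (k - 1)\<close> is \<open>F n\<close>, the algebra that makes \<open>?f\<close>
      measurable.\<close>
    have "AE \<omega> in M. nn_cond_exp M (F n) ?g \<omega> \<le> ennreal (exp (\<phi> l))"
      using c l unfolding cond_mgf_le_def by (metis diff_Suc_1 le_add1 plus_1_eq_Suc)
    then show "AE \<omega> in M. ?f \<omega> * nn_cond_exp M (F n) ?g \<omega> \<le> ?f \<omega> * ennreal (exp (\<phi> l))"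
      by eventually_elim (rule mult_left_mono, auto)
  qed
  also have "\<dots> = (\<integral>\<^sup>+\<omega>. ?f \<omega> \<partial>M) * ennreal (exp (\<phi> l))"
    by (rule nn_integral_multc) measurable
  also have "\<dots> \<le> ennreal (exp (real n * \<phi> l)) * ennreal (exp (\<phi> l))"
    by (intro mult_right_mono Suc.IH) simp
  also have "\<dots> = ennreal (exp (real (Suc n) * \<phi> l))"
    by (simp add: ennreal_mult'[symmetric] exp_add[symmetric] algebra_simps)
  finally show ?case .
qed

lemma Q_tail_le_exp:
  assumes "prob_space M" "is_filtration M F" "martingale_differences M F \<xi>"
    and "cond_mgf_le M F l0 \<phi> \<xi>" "l \<in> dom_of l0" "0 \<le> l" "1 \<le> n"
  shows "Q_tail M \<xi> n x \<le> exp (real n * \<phi> l - l * (real n * x))"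
proof -
  interpret prob_space M by fact
  let ?S = "partial_sum \<xi> n"
  let ?A = "{\<omega> \<in> space M. ?S \<omega> / real n > x}"
  have [measurable]: "?S \<in> borel_measurable M"
    using partial_sum_measurable[OF assms(2,3) order_refl] assms(2)
    by (auto simp: is_filtration_def intro: measurable_from_subalg)
  have le: "l * (real n * x) \<le> l * ?S \<omega>" if "\<omega> \<in> ?A" for \<omega>
    using that assms(6,7) by (intro mult_left_mono) (auto simp: field_simps)
  have "emeasure M ?A = (\<integral>\<^sup>+\<omega>. indicator ?A \<omega> \<partial>M)" by simp
  \<comment> \<open>On \<open>?A\<close> the product is
    \<open>exp (l * (?S \<omega> - real n * x))\<close>, which is at least 1 because
    \<open>0 \<le> l\<close>; off \<open>?A\<close> the indicator is 0.\<close>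
  also have "\<dots> \<le> (\<integral>\<^sup>+\<omega>. ennreal (exp (- (l * (real n * x)))) * ennreal (exp (l * ?S \<omega>)) \<partial>M)"
  proof (rule nn_integral_mono)
    fix \<omega>
    show "indicator ?A \<omega> \<le> ennreal (exp (- (l * (real n * x)))) * ennreal (exp (l * ?S \<omega>))"
      using le[of \<omega>] by (cases "\<omega> \<in> ?A")
        (auto simp: ennreal_mult'[symmetric] exp_add[symmetric] simp del: mem_Collect_eq)
  qed
  also have "\<dots> = ennreal (exp (- (l * (real n * x)))) * (\<integral>\<^sup>+\<omega>. ennreal (exp (l * ?S \<omega>)) \<partial>M)"
    by (rule nn_integral_cmult) measurable
  also have "\<dots> \<le> ennreal (exp (- (l * (real n * x)))) * ennreal (exp (real n * \<phi> l))"
    by (intro mult_left_mono nn_integral_exp_partial_sum_le[OF assms(1-5)]) simp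
  also have "\<dots> = ennreal (exp (real n * \<phi> l - l * (real n * x)))"
    by (simp add: ennreal_mult'[symmetric] exp_add[symmetric] algebra_simps)
  finally show ?thesis unfolding Q_tail_def by (simp add: emeasure_eq_measure)
qed

text \<open>Links one \<open>n\<close> to the supremum over all \<open>n\<close>. The absolute
  value, harmless as \<phi> is even, matches the nonnegative parameter that the exponential Markov
  bound requires.\<close>

lemma Phi_scaled_le_phi_bar:
  assumes \<phi>: "\<phi> \<in> Phi l0" and l: "l \<in> dom_of l0" and n: "1 \<le> n"
  shows "real n * \<phi> (\<bar>l\<bar> / sqrt (real n)) \<le> phi_bar \<phi> l"
proof -
  have "\<bar>l / sqrt (real n)\<bar> \<le> \<bar>l\<bar>" using n by (simp add: field_simps mult_le_cancel_left1)
  then have "l / sqrt (real n) \<in> dom_of l0" by (rule dom_of_abs_le[OF l])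
  then have "\<phi> (\<bar>l\<bar> / sqrt (real n)) = \<phi> (l / sqrt (real n))"
    using Phi_even[OF \<phi>, of "l / sqrt (real n)"] by simp
  then show ?thesis
    using cSUP_upper[OF _ bdd_above_phi_bar[OF \<phi>], of n l] n by (simp add: phi_bar_def)
qed

lemma Q_tail_le_exp_young_fenchel:
  assumes "prob_space M" "is_filtration M F" and \<phi>: "\<phi> \<in> Phi l0"
    and "martingale_differences M F \<xi>" "cond_mgf_le M F l0 \<phi> \<xi>" and n: "1 \<le> n" and x: "0 < x"
  shows "Q_tail M \<xi> n x \<le> exp (- young_fenchel l0 (phi_bar \<phi>) (x * sqrt (real n)))"
\<comment> \<open>For a positive tail one can take logarithms:
  \<open>- ln (Q_tail M \<xi> n x)\<close> is then an upper bound, uniform in \<open>l\<close>, for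
  the terms of the transform. A zero tail lies below any exponential.\<close>
proof (cases "Q_tail M \<xi> n x > 0")
  case True
  let ?u = "x * sqrt (real n)"
  have "l * ?u - phi_bar \<phi> l \<le> - ln (Q_tail M \<xi> n x)" if l: "l \<in> dom_of l0" for l
  proof -
    let ?l = "\<bar>l\<bar> / sqrt (real n)"
    have "\<bar>?l\<bar> \<le> \<bar>l\<bar>" using n by (simp add: field_simps mult_le_cancel_left1)
    then have "?l \<in> dom_of l0" by (rule dom_of_abs_le[OF l])
    then have "Q_tail M \<xi> n x \<le> exp (real n * \<phi> ?l - ?l * (real n * x))"
      using assms by (intro Q_tail_le_exp) auto
    then have "ln (Q_tail M \<xi> n x) \<le> real n * \<phi> ?l - ?l * (real n * x)"
      using True by (metis ln_exp ln_le_cancel_iff exp_gt_zero)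
    moreover have "?l * (real n * x) = \<bar>l\<bar> * ?u"
      using n by (simp add: field_simps real_sqrt_mult_self)
    \<comment> \<open>Negative \<open>l\<close> is covered by \<open>\<bar>l\<bar>\<close>: as
      \<open>?u\<close> is positive, changing the sign only increases the linear term.\<close>
    moreover have "l * ?u \<le> \<bar>l\<bar> * ?u" using x by (intro mult_right_mono) auto
    ultimately show ?thesis using Phi_scaled_le_phi_bar[OF \<phi> l n] by linarith
  qed
  \<comment> \<open>A real supremum can be bounded termwise only over a nonempty set;
    \<open>0\<close> is in the domain because \<open>l0\<close> is positive.\<close>
  moreover have "dom_of l0 \<noteq> {}"
    using \<phi> by (auto simp: Phi_def dom_of_def zero_ereal_def intro!: exI[of _ 0])
  ultimately have "young_fenchel l0 (phi_bar \<phi>) ?u \<le> - ln (Q_tail M \<xi> n x)"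
    unfolding young_fenchel_def by (intro cSUP_least)
  then have "exp (ln (Q_tail M \<xi> n x)) \<le> exp (- young_fenchel l0 (phi_bar \<phi>) ?u)" by simp
  then show ?thesis using True by simp
next
  case False
  then show ?thesis by (smt (verit) exp_gt_zero)
qed

theorem theorem4p1:
  fixes M :: "'a measure" and F :: "nat \<Rightarrow> 'a measure"
    and \<xi> :: "nat \<Rightarrow> 'a \<Rightarrow> real" and \<phi> :: "real \<Rightarrow> real" and l0 :: ereal
  assumes "prob_space M"
    and "is_filtration M F"
    and "\<phi> \<in> Phi l0"
    and "martingale_differences M F \<xi>"
  shows "(norms_le_1 M F l0 \<phi> \<xi> \<longleftrightarrow> cond_mgf_le M F l0 \<phi> \<xi>) \<and>
    (norms_le_1 M F l0 \<phi> \<xi> \<longrightarrow>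
      (\<forall>n\<ge>1. \<forall>x>0. Q_tail M \<xi> n x \<le> 2 * exp (- young_fenchel l0 (phi_bar \<phi>) (x * sqrt (real n)))))"
proof (intro conjI impI allI)
  show iff: "norms_le_1 M F l0 \<phi> \<xi> \<longleftrightarrow> cond_mgf_le M F l0 \<phi> \<xi>"
    using assms(3,4) by (rule norms_le_1_iff_cond_mgf_le)
  fix n :: nat and x :: real
  assume "norms_le_1 M F l0 \<phi> \<xi>" and "1 \<le> n" "0 < x"
  then have "Q_tail M \<xi> n x \<le> exp (- young_fenchel l0 (phi_bar \<phi>) (x * sqrt (real n)))"
    using assms iff by (intro Q_tail_le_exp_young_fenchel) auto
  also have "\<dots> \<le> 2 * exp (- young_fenchel l0 (phi_bar \<phi>) (x * sqrt (real n)))" by simp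
  finally show "Q_tail M \<xi> n x \<le> 2 * exp (- young_fenchel l0 (phi_bar \<phi>) (x * sqrt (real n)))" .
qed

end
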